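(* Let $\{k_n\}_{n=0}^\infty$ be a building sequence of the family of random multi-hooking networks $\{G_n\}_{n\ge 1}$, starting from a seed $G_0$ with $\tau_0\ge 2$ vertices and total path length $T_0$. Let $D_n$ be the depth of a uniformly randomly selected node in the $n$th network $G_n$. Then $$\mathbb{E}[D_n]=T_0\sum_{i=1}^n\frac{k_{i-1}}{\tau_i}+\mathbb{E}[D_0],$$ where $\mathbb{E}[D_0]=T_0/\tau_0$ is the average depth in the seed.
   Context: Seed. $G_0$ is a connected finite graph (loops and multiple edges are allowed) with $\tau_0\ge 2$ vertices, one of which is designated as the hook $h$. Building sequence. A sequence of integers $\{k_n\}_{n=0}^\infty$ with $k_n\ge 1$ is a building sequence (for a seed of order $\tau_0$) if: (i) $k_n\le \tau_0+(\tau_0-1)\sum_{i=0}^{n-1}k_i$ for all $n\ge 0$; (ii) the limit $a:=\lim_{n\to\infty} k_n/\sum_{i=0}^n k_i$ exists in $[0,1]$; (iii) the limit $b:=\lim_{n\to\infty}\tau_0/k_n\ge 0$ exists. Random multi-hooking network. For $n\ge 1$, given $G_{n-1}=(V_{n-1},\mathcal{E}_{n-1})$, a set of $k_{n-1}$ distinct vertices of $G_{n-1}$, called latches, is chosen uniformly at random among all subsets of $V_{n-1}$ of size $k_{n-1}$ (given the whole past). For each latch a fresh copy of the seed is taken and its hook is fused (identified) with the latch; distinct latches receive distinct copies. The result is $G_n$. The order of $G_n$ is deterministic: $\tau_n=|V_n|=\tau_0+(\tau_0-1)\sum_{i=1}^n k_{i-1}$. Depth. The reference vertex of $G_n$ is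 the hook of the initial seed $G_0$ (viewed as a vertex of $G_n$). The depth of a vertex of $G_n$ is its graph distance in $G_n$ (number of edges on a shortest path) to the reference vertex. The total path length $T_0$ of the seed is the sum of the depths of all vertices of $G_0$. Given $G_n$, the node whose depth is $D_n$ is chosen uniformly among the $\tau_n$ vertices of $G_n$. *)

theory Defs
  imports "HOL-Probability.Probability_Mass_Function" "HOL-Library.Uprod"
begin

text \<open>
  Finite undirected multigraphs: edges are a multiset of unordered pairs, so parallel edges
  are counted with multiplicity, and \<open>Upair v v\<close> is a loop at \<open>v\<close>.
\<close>

record 'v mgraph =
  verts :: "'v set"
  edges :: "'v uprod multiset"

definition wf_mgraph :: "'v mgraph \<Rightarrow> bool" where
  "wf_mgraph G \<longleftrightarrow> finite (verts G) \<and> (\<forall>e \<in># edges G. set_uprod e \<subseteq> verts G)"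

definition is_path :: "'v mgraph \<Rightarrow> 'v \<Rightarrow> 'v list \<Rightarrow> 'v \<Rightarrow> bool" where
  "is_path G u p v \<longleftrightarrow>
     p \<noteq> [] \<and> hd p = u \<and> last p = v \<and> distinct p \<and> set p \<subseteq> verts G \<and>
     successively (\<lambda>x y. Upair x y \<in># edges G) p"

definition connected_mgraph :: "'v mgraph \<Rightarrow> bool" where
  "connected_mgraph G \<longleftrightarrow>
     verts G \<noteq> {} \<and> (\<forall>u \<in> verts G. \<forall>v \<in> verts G. \<exists>p. is_path G u p v)"

text \<open>A path with \<open>m\<close> edges is a list of \<open>m + 1\<close> vertices. The value is meaningful only if
  the two vertices are joined by a path.\<close>

definition gdist :: "'v mgraph \<Rightarrow> 'v \<Rightarrow> 'v \<Rightarrow> nat" where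
  "gdist G u v = (LEAST m. \<exists>p. is_path G u p v \<and> length p = Suc m)"

definition seed :: "'v mgraph \<Rightarrow> 'v \<Rightarrow> bool" where
  "seed S h \<longleftrightarrow> wf_mgraph S \<and> connected_mgraph S \<and> card (verts S) \<ge> 2 \<and> h \<in> verts S"

definition total_path_length :: "'v mgraph \<Rightarrow> 'v \<Rightarrow> nat" where
  "total_path_length S h = (\<Sum>v\<in>verts S. gdist S v h)"

definition building_sequence :: "nat \<Rightarrow> (nat \<Rightarrow> nat) \<Rightarrow> bool" where
  "building_sequence t k \<longleftrightarrow>
     (\<forall>n. 1 \<le> k n) \<and>
     (\<forall>n. k n \<le> t + (t - 1) * (\<Sum>i<n. k i)) \<and>
     (\<exists>a\<in>{0..1::real}. (\<lambda>n. real (k n) / real (\<Sum>i\<le>n. k i)) \<longlonglongrightarrow> a) \<and>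
     (\<exists>b\<ge>0::real. (\<lambda>n. real t / real (k n)) \<longlonglongrightarrow> b)"

text \<open>
  Vertex names: \<open>Root v\<close> is the vertex \<open>v\<close> of the initial seed, and \<open>Copy n l v\<close> is the
  non-hook vertex \<open>v\<close> of the seed copy fused at the latch \<open>l\<close> when the \<open>n\<close>-th network is built.
  The step index and the latch make all these names fresh and the copies disjoint.
\<close>

datatype 'v vertex = Root 'v | Copy nat "'v vertex" 'v

definition glue :: "nat \<Rightarrow> 'v \<Rightarrow> 'v vertex \<Rightarrow> 'v \<Rightarrow> 'v vertex" where
  "glue n h l v = (if v = h then l else Copy n l v)"

definition initial_network :: "'v mgraph \<Rightarrow> 'v vertex mgraph" where
  "initial_network S =
     \<lparr>verts = Root ` verts S, edges = image_mset (map_uprod Root) (edges S)\<rparr>"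

definition hook_at ::
  "'v mgraph \<Rightarrow> 'v \<Rightarrow> nat \<Rightarrow> 'v vertex set \<Rightarrow> 'v vertex mgraph \<Rightarrow> 'v vertex mgraph" where
  "hook_at S h n L G =
     \<lparr>verts = verts G \<union> (\<Union>l\<in>L. glue n h l ` verts S),
      edges = edges G + (\<Sum>l\<in>L. image_mset (map_uprod (glue n h l)) (edges S))\<rparr>"

text \<open>
  The law of the \<open>n\<close>-th network. The vertex names of a network record the latch set of every
  earlier step, so drawing the latches given the current network is the same as drawing them
  given the whole past.
\<close>

primrec network :: "'v mgraph \<Rightarrow> 'v \<Rightarrow> (nat \<Rightarrow> nat) \<Rightarrow> nat \<Rightarrow> 'v vertex mgraph pmf" where
  "network S h k 0 = return_pmf (initial_network S)"
| "network S h k (Suc n) = do {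
     G \<leftarrow> network S h k n;
     L \<leftarrow> pmf_of_set {L. L \<subseteq> verts G \<and> card L = k n};
     return_pmf (hook_at S h (Suc n) L G)
   }"

text \<open>The deterministic order of the \<open>n\<close>-th network; see \<open>card_verts_network\<close> below.\<close>

definition network_order :: "'v mgraph \<Rightarrow> (nat \<Rightarrow> nat) \<Rightarrow> nat \<Rightarrow> nat" where
  "network_order S k n = card (verts S) + (card (verts S) - 1) * (\<Sum>i=1..n. k (i - 1))"

text \<open>The law of the depth \<open>D\<^sub>n\<close> of a uniformly chosen vertex of the \<open>n\<close>-th network.\<close>

definition depth_pmf :: "'v mgraph \<Rightarrow> 'v \<Rightarrow> (nat \<Rightarrow> nat) \<Rightarrow> nat \<Rightarrow> nat pmf" where
  "depth_pmf S h k n = do {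
     G \<leftarrow> network S h k n;
     v \<leftarrow> pmf_of_set (verts G);
     return_pmf (gdist G v (Root h))
   }"

definition expected_depth :: "'v mgraph \<Rightarrow> 'v \<Rightarrow> (nat \<Rightarrow> nat) \<Rightarrow> nat \<Rightarrow> real" where
  "expected_depth S h k n = measure_pmf.expectation (depth_pmf S h k n) real"

primrec born :: "'v vertex \<Rightarrow> nat" where
  "born (Root v) = 0"
| "born (Copy n l v) = n"

lemma verts_hook_at:
  assumes "L \<subseteq> verts G" "h \<in> verts S"
  shows "verts (hook_at S h n L G) =
    verts G \<union> (\<lambda>(l, v). Copy n l v) ` (L \<times> (verts S - {h}))"
  using assms by (auto simp: hook_at_def glue_def image_iff)

lemma sum_shift: "(\<Sum>i=1..n. k (i - 1)) = (\<Sum>i<n. k i)" for k :: "nat \<Rightarrow> nat"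
  by (induction n) auto

lemma latch_sets:
  assumes "finite V" "m \<le> card V"
  shows "finite {L. L \<subseteq> V \<and> card L = m}" "{L. L \<subseteq> V \<and> card L = m} \<noteq> {}"
proof -
  show "finite {L. L \<subseteq> V \<and> card L = m}"
    using assms(1) by simp
  obtain L where "L \<subseteq> V" "card L = m"
    using obtain_subset_with_card_n[OF assms(2)] by blast
  then show "{L. L \<subseteq> V \<and> card L = m} \<noteq> {}" by blast
qed

lemma network_invariant:
  assumes "seed S h" "building_sequence (card (verts S)) k" "G \<in> set_pmf (network S h k n)"
  shows "finite (verts G) \<and> card (verts G) = network_order S k n \<and>
         (\<forall>v\<in>verts G. born v \<le> n)"
  using assms(3)
proof (induction n arbitrary: G)
  case 0
  have "finite (verts S)" using assms(1) by (simp add: seed_def wf_mgraph_def)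
  moreover have "card (Root ` verts S) = card (verts S)"
    by (intro card_image) (auto simp: inj_on_def)
  ultimately show ?case using 0
    by (auto simp: initial_network_def network_order_def)
next
  case (Suc n)
  from assms(1) have S: "finite (verts S)" "h \<in> verts S"
    by (auto simp: seed_def wf_mgraph_def)
  from Suc.prems obtain H where H: "H \<in> set_pmf (network S h k n)"
    and G: "G \<in> set_pmf (do {L \<leftarrow> pmf_of_set {L. L \<subseteq> verts H \<and> card L = k n};
                              return_pmf (hook_at S h (Suc n) L H)})"
    by auto
  note IH = Suc.IH[OF H]
  have "k n \<le> card (verts H)"
    using assms(2) IH unfolding building_sequence_def network_order_def sum_shift by simp
  note ls = latch_sets[OF _ this]
  from G IH obtain L where L: "L \<subseteq> verts H" "card L = k n" and Geq: "G = hook_at S h (Suc n) L H"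
    by (auto simp: set_pmf_of_set[OF ls(2) ls(1)])
  let ?N = "(\<lambda>(l, v). Copy (Suc n) l v) ` (L \<times> (verts S - {h}))"
  have V: "verts G = verts H \<union> ?N" using verts_hook_at[OF L(1) S(2)] Geq by simp
  have fL: "finite L" using IH L(1) finite_subset by blast
  have fN: "finite ?N" using fL S(1) by simp
  have "card ?N = card (L \<times> (verts S - {h}))"
    by (intro card_image) (auto simp: inj_on_def)
  also have "\<dots> = k n * (card (verts S) - 1)"
    using S L(2) by (simp add: card_cartesian_product)
  finally have cN: "card ?N = k n * (card (verts S) - 1)" .
  have "verts H \<inter> ?N = {}" using IH by force
  then have "card (verts G) = network_order S k n + k n * (card (verts S) - 1)"
    using V IH fN cN by (simp add: card_Un_disjoint)
  then have "card (verts G) = network_order S k (Suc n)"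
    by (simp add: network_order_def algebra_simps)
  then show ?case using V IH fN by (auto intro: le_SucI)
qed

lemma card_verts_network:
  assumes "seed S h" "building_sequence (card (verts S)) k" "G \<in> set_pmf (network S h k n)"
  shows "card (verts G) = network_order S k n"
  using network_invariant[OF assms] by blast

end

theory Submission imports Defs begin

text \<open>
  Fusing a copy of the seed at a latch \<open>l\<close> leaves the depths of the old vertices unchanged and
  gives the new vertex \<open>v\<close> of the copy the depth of \<open>l\<close> plus the depth of \<open>v\<close> in the seed. Hence
  the total path length \<open>P\<close> grows by \<open>(\<tau>\<^sub>0 - 1) \<cdot> depth l + T\<^sub>0\<close> at each latch. A uniform latch set of
  size \<open>k\<close> contains every vertex with the same probability \<open>k / \<tau>\<close>, so on average \<open>P\<close> becomes
  \<open>P + k (\<tau>\<^sub>0 - 1) P / \<tau> + k T\<^sub>0 = P \<tau>' / \<tau> + k T\<^sub>0\<close>, with \<open>\<tau>' = \<tau> + k (\<tau>\<^sub>0 - 1)\<close> the new order.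
  Dividing by \<open>\<tau>'\<close> gives a telescoping recursion for the mean depth.
\<close>

section \<open>Distances in multigraphs\<close>

lemma gdist_less_length:
  assumes "is_path G u p v"
  shows "gdist G u v < length p"
proof -
  obtain m where m: "length p = Suc m"
    using assms by (cases p) (auto simp: is_path_def)
  have "gdist G u v \<le> m"
    unfolding gdist_def using assms m by (blast intro: Least_le)
  with m show ?thesis by simp
qed

lemma shortest_path:
  assumes "is_path G u p v"
  obtains q where "is_path G u q v" "length q = Suc (gdist G u v)"
proof -
  obtain m where "length p = Suc m"
    using assms by (cases p) (auto simp: is_path_def)
  then have "\<exists>q. is_path G u q v \<and> length q = Suc m"
    using assms by blast
  then have "\<exists>q. is_path G u q v \<and> length q = Suc (gdist G u v)"
    unfolding gdist_def by (rule LeastI)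
  with that show ?thesis by blast
qed

text \<open>\<open>is_path\<close> forbids repeated vertices, so \<open>x\<close> cannot simply be
  prepended. If \<open>x\<close> already lies on \<open>p\<close>, the suffix of \<open>p\<close>
  that starts at \<open>x\<close> serves and is no longer than \<open>p\<close>.\<close>

lemma path_extend:
  assumes "Upair x y \<in># edges G" "x \<in> verts G" "is_path G y p r"
  shows "\<exists>q. is_path G x q r \<and> length q \<le> Suc (length p)"
proof (cases "x \<in> set p")
  case True
  then obtain p1 p2 where p: "p = p1 @ x # p2"
    by (meson split_list)
  then have "is_path G x (x # p2) r"
    using assms(3) by (auto simp: is_path_def successively_append_iff)
  with p show ?thesis by (intro exI[of _ "x # p2"]) simp
next
  case False
  then have "is_path G x (x # p) r"
    using assms by (auto simp: is_path_def successively_Cons)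
  then show ?thesis by (intro exI[of _ "x # p"]) simp
qed

text \<open>Turns a walk with possible repetitions into a path by prepending its vertices one at a
  time. The bound is strict because \<open>last w\<close> is counted in both lists.\<close>

lemma path_extend_walk:
  assumes "successively (\<lambda>x y. Upair x y \<in># edges G) w" "w \<noteq> []" "set w \<subseteq> verts G"
    and "is_path G (last w) p r"
  shows "\<exists>q. is_path G (hd w) q r \<and> length q < length w + length p"
  using assms
proof (induction w)
  case (Cons x w)
  show ?case
  proof (cases "w = []")
    case True
    with Cons.prems show ?thesis by auto
  next
    case False
    with Cons obtain q where "is_path G (hd w) q r" "length q < length w + length p"
      by (auto simp: successively_Cons)
    moreover have "Upair x (hd w) \<in># edges G" "x \<in> verts G"
      using Cons.prems False by (auto simp: successively_Cons)
    ultimately show ?thesis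
      using path_extend[of x "hd w" G q r] by fastforce
  qed
qed simp

lemma gdist_edge_le:
  assumes "Upair x y \<in># edges G" "x \<in> verts G" "is_path G y p r"
  shows "gdist G x r \<le> Suc (gdist G y r)"
proof -
  obtain q where "is_path G y q r" "length q = Suc (gdist G y r)"
    using shortest_path[OF assms(3)] .
  with path_extend[OF assms(1,2)] obtain q' where
    "is_path G x q' r" "length q' \<le> Suc (Suc (gdist G y r))" by metis
  with gdist_less_length[of G x q' r] show ?thesis by simp
qed

text \<open>Each edge lowers \<open>d\<close> by at most one, and a walk of \<open>length w\<close>
  vertices has one edge fewer; hence the strict inequality.\<close>

lemma potential_walk_le:
  fixes d :: "'a \<Rightarrow> nat"
  assumes "\<And>x y. Upair x y \<in># edges G \<Longrightarrow> d x \<le> Suc (d y)"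
    and "successively (\<lambda>x y. Upair x y \<in># edges G) w" "w \<noteq> []"
  shows "d (hd w) < d (last w) + length w"
  using assms(2,3)
proof (induction w)
  case (Cons x w)
  show ?case
  proof (cases "w = []")
    case False
    then have "d x \<le> Suc (d (hd w))" "d (hd w) < d (last w) + length w"
      using Cons assms(1) by (auto simp: successively_Cons)
    with False show ?thesis by simp
  qed simp
qed simp

text \<open>A certificate for a distance: the potential \<open>d\<close> bounds every path to
  \<open>r\<close> from below, and one path attains the bound. Distances in a larger graph thus
  follow without any analysis of how its paths run.\<close>

lemma gdist_eqI:
  fixes d :: "'a \<Rightarrow> nat"
  assumes pot: "\<And>x y. Upair x y \<in># edges G \<Longrightarrow> d x \<le> Suc (d y)" and "d r = 0"
    and p: "is_path G v p r" "length p \<le> Suc (d v)"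
  shows "gdist G v r = d v"
proof -
  obtain q where q: "is_path G v q r" "length q = Suc (gdist G v r)"
    using shortest_path[OF p(1)] .
  then have "d v < length q"
    using potential_walk_le[of G d q] pot \<open>d r = 0\<close> by (auto simp: is_path_def)
  moreover have "gdist G v r < length p"
    using p(1) by (rule gdist_less_length)
  ultimately show ?thesis using q(2) p(2) by simp
qed

lemma is_path_refl: "v \<in> verts G \<Longrightarrow> is_path G v [v] v"
  by (simp add: is_path_def)

lemma gdist_refl: "v \<in> verts G \<Longrightarrow> gdist G v v = 0"
  using gdist_less_length[OF is_path_refl] by fastforce

lemma wf_mgraph_edge:
  assumes "wf_mgraph G" "Upair x y \<in># edges G"
  shows "x \<in> verts G" "y \<in> verts G"
  using assms by (auto simp: wf_mgraph_def)

text \<open>The form of connectedness that makes each depth \<open>gdist G v r\<close> meaningful;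
  it serves as the invariant of the building process.\<close>

definition rooted :: "'v mgraph \<Rightarrow> 'v \<Rightarrow> bool" where
  "rooted G r \<longleftrightarrow> wf_mgraph G \<and> r \<in> verts G \<and> (\<forall>v\<in>verts G. \<exists>p. is_path G v p r)"

lemma rooted_edge_le:
  assumes "rooted G r" "Upair x y \<in># edges G"
  shows "gdist G x r \<le> Suc (gdist G y r)"
  using assms wf_mgraph_edge[of G x y] gdist_edge_le[of x y G] by (auto simp: rooted_def)

lemma rooted_shortest_path:
  assumes "rooted G r" "v \<in> verts G"
  obtains p where "is_path G v p r" "length p = Suc (gdist G v r)"
  using assms shortest_path unfolding rooted_def by metis

lemma seed_rooted: "seed S h \<Longrightarrow> rooted S h"
  by (auto simp: seed_def rooted_def connected_mgraph_def)

lemma Upair_eq_map_uprodE: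
  assumes "Upair x y = map_uprod f e"
  obtains a b where "e = Upair a b" "x = f a" "y = f b"
proof -
  obtain a b where e: "e = Upair a b" by (cases e)
  \<comment> \<open>Equality of unordered pairs also allows \<open>x = f b\<close> and
    \<open>y = f a\<close>; the swapped reading of \<open>e\<close> covers that case.\<close>
  then have "e = Upair b a" by simp
  with e that assms show thesis by auto
qed

text \<open>The image of a path under a homomorphism is only a walk, as \<open>f\<close> may
  identify vertices; \<open>path_extend_walk\<close> shortens it while continuing along
  \<open>q\<close>.\<close>

lemma hom_path:
  assumes hom: "\<And>x y. Upair x y \<in># edges G \<Longrightarrow> Upair (f x) (f y) \<in># edges H"
    and "f ` verts G \<subseteq> verts H" "is_path G u p v" "is_path H (f v) q r"
  shows "\<exists>q'. is_path H (f u) q' r \<and> length q' < length p + length q"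
proof -
  have "successively (\<lambda>x y. Upair x y \<in># edges H) (map f p)"
    using assms(3) hom by (auto simp: is_path_def successively_map elim: successively_mono)
  moreover have "map f p \<noteq> []" "set (map f p) \<subseteq> verts H"
    "hd (map f p) = f u" "last (map f p) = f v"
    using assms(2,3) by (auto simp: is_path_def hd_map last_map)
  ultimately show ?thesis
    using path_extend_walk[of H "map f p" q r] assms(4) by simp
qed

section \<open>Total path length of the network\<close>

lemma initial_network_rooted:
  assumes "rooted S h"
  shows "rooted (initial_network S) (Root h)"
    and "total_path_length (initial_network S) (Root h) = total_path_length S h"
proof -
  let ?G = "initial_network S"
  \<comment> \<open>The potential for \<open>gdist_eqI\<close>. The value at \<open>Copy\<close>
    names is a dummy, since the initial network has none.\<close>
  define d where "d x = gdist S (case x of Root v \<Rightarrow> v | _ \<Rightarrow> h) h" for x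
  have verts: "verts ?G = Root ` verts S"
    by (simp add: initial_network_def)
  have wf: "wf_mgraph S" and h: "h \<in> verts S"
    using assms by (auto simp: rooted_def)
  have wf': "wf_mgraph ?G"
    using wf by (auto simp: wf_mgraph_def initial_network_def uprod.set_map)
  have edge: "\<exists>a b. x = Root a \<and> y = Root b \<and> Upair a b \<in># edges S"
    if "Upair x y \<in># edges ?G" for x y
  proof -
    from that have "Upair x y \<in> map_uprod Root ` set_mset (edges S)"
      by (simp add: initial_network_def)
    then show ?thesis
      by (auto elim!: Upair_eq_map_uprodE)
  qed
  have pot: "d x \<le> Suc (d y)" if "Upair x y \<in># edges ?G" for x y
    using edge[OF that] rooted_edge_le[OF assms] by (auto simp: d_def)
  have hom: "Upair (Root x) (Root y) \<in># edges ?G" if "Upair x y \<in># edges S" for x y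
    using imageI[OF that, of "map_uprod Root"] by (simp add: initial_network_def)
  have path: "\<exists>q. is_path ?G (Root v) q (Root h) \<and> length q \<le> Suc (gdist S v h)"
    if v: "v \<in> verts S" for v
  proof -
    obtain p where "is_path S v p h" "length p = Suc (gdist S v h)"
      using rooted_shortest_path[OF assms v] .
    \<comment> \<open>The image of \<open>p\<close> already ends in \<open>Root h\<close>, so the
      one-vertex path continues it; its length 1 turns the strict bound of \<open>hom_path\<close>
      into the desired one.\<close>
    moreover have "is_path ?G (Root h) [Root h] (Root h)"
      using h by (intro is_path_refl) (simp add: verts)
    ultimately show ?thesis
      using hom_path[of S Root ?G v p h "[Root h]" "Root h"] hom verts by fastforce
  qed
  show "rooted ?G (Root h)"
    using wf' h path by (force simp: rooted_def verts)
  have "gdist ?G (Root v) (Root h) = gdist S v h" if "v \<in> verts S" for v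
    using path[OF that] gdist_eqI[of ?G d "Root h"] pot gdist_refl[OF h] by (auto simp: d_def)
  then show "total_path_length ?G (Root h) = total_path_length S h"
    by (simp add: total_path_length_def verts sum.reindex inj_on_def)
qed

section \<open>Depths after one hooking step with a fixed latch set\<close>

context
  fixes S :: "'v mgraph" and h :: 'v and G :: "'v vertex mgraph" and r :: "'v vertex"
    and L :: "'v vertex set" and n :: nat
  assumes S: "rooted S h" and G: "rooted G r" and L: "L \<subseteq> verts G"
    and fresh: "\<And>l v. Copy n l v \<notin> verts G"
begin

private abbreviation (input) "H \<equiv> hook_at S h n L G"

text \<open>The conjectured depth in \<open>H\<close>, to be used as the potential in
  \<open>gdist_eqI\<close>. Its values at names outside \<open>H\<close> are arbitrary.\<close>

private definition hook_depth :: "'v vertex \<Rightarrow> nat" where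
  "hook_depth x = (if x \<in> verts G then gdist G x r else
     case x of Copy _ l v \<Rightarrow> gdist S v h + gdist G l r | _ \<Rightarrow> 0)"

private lemma h: "h \<in> verts S" and fin: "finite (verts S)" "finite (verts G)" "finite L"
  using S G L finite_subset[of L "verts G"] by (auto simp: rooted_def wf_mgraph_def)

text \<open>For \<open>v = h\<close> the glued vertex is the latch itself and the seed depth is 0,
  so both branches agree; for other \<open>v\<close>, freshness selects the second branch.\<close>

private lemma hook_depth_glue:
  "l \<in> L \<Longrightarrow> hook_depth (glue n h l v) = gdist S v h + gdist G l r"
  using L fresh gdist_refl[OF h] by (auto simp: hook_depth_def glue_def)

private lemma edges_hook_at:
  "e \<in># edges H \<longleftrightarrow>
     e \<in># edges G \<or> (\<exists>l\<in>L. \<exists>e'\<in>#edges S. e = map_uprod (glue n h l) e')"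
  using fin by (auto simp: hook_at_def set_mset_sum)

text \<open>Every edge of \<open>H\<close> lies in \<open>G\<close> or in a single copy, and on the
  copy at \<open>l\<close> the potential is the seed depth shifted by the constant depth of
  \<open>l\<close>.\<close>

private lemma hook_depth_potential:
  assumes "Upair x y \<in># edges H"
  shows "hook_depth x \<le> Suc (hook_depth y)"
proof -
  consider "Upair x y \<in># edges G" |
    l e where "l \<in> L" "e \<in># edges S" "Upair x y = map_uprod (glue n h l) e"
    using assms edges_hook_at by blast
  then show ?thesis
  proof cases
    case 1
    moreover have "x \<in> verts G" "y \<in> verts G"
      using 1 G wf_mgraph_edge[of G x y] by (auto simp: rooted_def)
    ultimately show ?thesis
      using rooted_edge_le[OF G 1] by (simp add: hook_depth_def)
  next
    case 2
    then obtain a b where ab: "e = Upair a b" "x = glue n h l a" "y = glue n h l b"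
      by (elim Upair_eq_map_uprodE)
    then have "gdist S a h \<le> Suc (gdist S b h)"
      using rooted_edge_le[OF S] 2(2) by simp
    then show ?thesis
      using ab 2(1) by (simp add: hook_depth_glue)
  qed
qed

private lemma old_path:
  assumes "v \<in> verts G"
  shows "\<exists>p. is_path H v p r \<and> length p \<le> Suc (gdist G v r)"
proof -
  obtain p where "is_path G v p r" "length p = Suc (gdist G v r)"
    using rooted_shortest_path[OF G assms] .
  then show ?thesis
    by (intro exI[of _ p])
      (auto simp: is_path_def edges_hook_at hook_at_def elim: successively_mono)
qed

text \<open>Walk inside the copy to its hook, which is the latch \<open>l\<close>, and go on from
  there along an old path to \<open>r\<close>.\<close>

private lemma new_path:
  assumes "l \<in> L" "v \<in> verts S"
  shows "\<exists>p. is_path H (glue n h l v) p r \<and> length p \<le> Suc (gdist S v h + gdist G l r)"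
proof -
  obtain p where p: "is_path S v p h" "length p = Suc (gdist S v h)"
    using rooted_shortest_path[OF S assms(2)] .
  obtain q where q: "is_path H l q r" "length q \<le> Suc (gdist G l r)"
    using old_path assms(1) L by blast
  have "Upair (glue n h l x) (glue n h l y) \<in># edges H" if "Upair x y \<in># edges S" for x y
    using that assms(1) unfolding edges_hook_at by (intro disjI2 bexI[of _ l]) force+
  moreover have "glue n h l ` verts S \<subseteq> verts H"
    using assms(1) by (auto simp: hook_at_def)
  moreover have "glue n h l h = l" by (simp add: glue_def)
  ultimately have "\<exists>q'. is_path H (glue n h l v) q' r \<and> length q' < length p + length q"
    using hom_path[of S "glue n h l" H v p h q r] p(1) q(1) by metis
  with p(2) q(2) show ?thesis by fastforce
qed

lemma gdist_hook_at_old: "v \<in> verts G \<Longrightarrow> gdist H v r = gdist G v r"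
  using old_path[of v] gdist_eqI[of H hook_depth r v] hook_depth_potential gdist_refl[of r G] G
  by (auto simp: hook_depth_def rooted_def)

lemma gdist_hook_at_new:
  "l \<in> L \<Longrightarrow> v \<in> verts S \<Longrightarrow> gdist H (glue n h l v) r = gdist S v h + gdist G l r"
  using new_path[of l v] gdist_eqI[of H hook_depth r "glue n h l v"] hook_depth_potential
    gdist_refl[of r G] G
  by (auto simp: hook_depth_glue) (auto simp: hook_depth_def rooted_def)

lemma hook_at_rooted: "rooted H r"
proof -
  have "wf_mgraph H"
    unfolding wf_mgraph_def
  proof (intro conjI ballI)
    show "finite (verts H)" using fin by (simp add: hook_at_def)
    fix e assume "e \<in># edges H"
    then consider "e \<in># edges G" |
      l e' where "l \<in> L" "e' \<in># edges S" "e = map_uprod (glue n h l) e'"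
      unfolding edges_hook_at by blast
    then show "set_uprod e \<subseteq> verts H"
      using S G by cases (force simp: rooted_def wf_mgraph_def hook_at_def uprod.set_map)+
  qed
  moreover have "\<exists>p. is_path H v p r" if "v \<in> verts H" for v
  proof -
    from that consider "v \<in> verts G" | l u where "l \<in> L" "u \<in> verts S" "v = glue n h l u"
      by (auto simp: hook_at_def)
    then show ?thesis using old_path new_path by cases blast+
  qed
  ultimately show ?thesis
    using G by (auto simp: rooted_def hook_at_def)
qed

text \<open>Each copy adds only its non-hook vertices, so the depth of its latch is counted
  \<open>card (verts S) - 1\<close> times.\<close>

lemma total_path_length_hook_at:
  "total_path_length H r = total_path_length G r +
     (card (verts S) - 1) * (\<Sum>l\<in>L. gdist G l r) + card L * total_path_length S h"
proof -
  let ?c = "\<lambda>(l, v). Copy n l v"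
  let ?S = "verts S - {h}"
  have new: "gdist H (Copy n l v) r = gdist S v h + gdist G l r" if "l \<in> L" "v \<in> ?S" for l v
    using gdist_hook_at_new[of l v] that by (simp add: glue_def)
  have "total_path_length H r =
      total_path_length G r + (\<Sum>x\<in>?c ` (L \<times> ?S). gdist H x r)"
    unfolding total_path_length_def verts_hook_at[where S = S and h = h, OF L h]
    using fin fresh by (subst sum.union_disjoint) (auto simp: gdist_hook_at_old)
  also have "(\<Sum>x\<in>?c ` (L \<times> ?S). gdist H x r) = (\<Sum>(l, v)\<in>L \<times> ?S. gdist H (Copy n l v) r)"
    by (subst sum.reindex) (auto simp: inj_on_def case_prod_unfold)
  also have "\<dots> = (\<Sum>(l, v)\<in>L \<times> ?S. gdist S v h + gdist G l r)"
    using new by (intro sum.cong) auto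
  also have "\<dots> = (\<Sum>l\<in>L. \<Sum>v\<in>?S. gdist S v h + gdist G l r)"
    by (simp add: sum.cartesian_product)
  also have "\<dots> = (card (verts S) - 1) * (\<Sum>l\<in>L. gdist G l r) + card L * (\<Sum>v\<in>?S. gdist S v h)"
    using fin h by (simp add: sum.distrib sum_distrib_left)
  \<comment> \<open>The omitted hook has depth 0.\<close>
  also have "(\<Sum>v\<in>?S. gdist S v h) = total_path_length S h"
    using fin h gdist_refl[OF h] by (simp add: total_path_length_def sum.remove[of _ h])
  finally show ?thesis by simp
qed

end

section \<open>Expectations\<close>

text \<open>Double counting: exchange the sums and count the \<open>k\<close>-subsets that contain a
  given \<open>x\<close>, which make up the fraction \<open>k / card V\<close> of all of
  them.\<close>

lemma sum_over_subsets:
  fixes f :: "'a \<Rightarrow> real"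
  assumes "finite V" "V \<noteq> {}"
  shows "(\<Sum>L | L \<subseteq> V \<and> card L = k. \<Sum>x\<in>L. f x) =
    real (card V choose k) * (real k / real (card V)) * (\<Sum>x\<in>V. f x)"
proof -
  let ?A = "{L. L \<subseteq> V \<and> card L = k}"
  have count: "real (card {L \<in> ?A. x \<in> L}) = real (card V choose k) * (real k / real (card V))"
    if x: "x \<in> V" for x
  proof (cases k)
    case 0
    then have "{L \<in> ?A. x \<in> L} = {}"
      using assms(1) by (auto dest: finite_subset)
    with 0 show ?thesis by (simp only: card.empty)
  next
    case (Suc j)
    have "card V > 0" using assms by (simp add: card_gt_0_iff)
    then obtain N where N: "card V = Suc N" using gr0_conv_Suc by blast
    \<comment> \<open>Split the subsets by whether they contain \<open>x\<close>; Pascal's rule then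
      leaves \<open>N choose j\<close>, which the absorption identity below relates to
      \<open>card V choose k\<close>.\<close>
    have "card ?A = card {L \<in> ?A. x \<in> L} + card {L. L \<subseteq> V - {x} \<and> card L = k}"
      using assms(1) by (subst card_Un_disjoint[symmetric]) (auto intro!: arg_cong[of _ _ card])
    then have "card {L \<in> ?A. x \<in> L} = N choose j"
      using assms(1) x N Suc by (simp add: n_subsets)
    moreover have "real (Suc j) * real (Suc N choose Suc j) = real (Suc N) * real (N choose j)"
      by (metis Suc_times_binomial_eq mult.commute of_nat_mult)
    ultimately show ?thesis
      unfolding N Suc by (simp add: field_simps)
  qed
  have "(\<Sum>L\<in>?A. \<Sum>x\<in>L. f x) = (\<Sum>L\<in>?A. \<Sum>x | x \<in> V \<and> x \<in> L. f x)"
    by (intro sum.cong refl) auto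
  also have "\<dots> = (\<Sum>x\<in>V. \<Sum>L | L \<in> ?A \<and> x \<in> L. f x)"
    using assms(1) by (intro sum.swap_restrict) auto
  also have "\<dots> = (\<Sum>x\<in>V. real (card {L \<in> ?A. x \<in> L}) * f x)"
    by simp
  also have "\<dots> = real (card V choose k) * (real k / real (card V)) * (\<Sum>x\<in>V. f x)"
    unfolding sum_distrib_left using count by (intro sum.cong) auto
  finally show ?thesis .
qed

lemma expectation_uniform_subset:
  fixes f :: "'a \<Rightarrow> real"
  assumes "finite V" "V \<noteq> {}" "k \<le> card V"
  shows "measure_pmf.expectation (pmf_of_set {L. L \<subseteq> V \<and> card L = k}) (\<lambda>L. \<Sum>x\<in>L. f x) =
    real k / real (card V) * (\<Sum>x\<in>V. f x)"
proof -
  note ls = latch_sets[OF assms(1,3)]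
  have "card V choose k > 0" using assms(3) by simp
  then show ?thesis
    using ls sum_over_subsets[where f = f and k = k, OF assms(1,2)]
    by (simp add: integral_pmf_of_set n_subsets[OF assms(1)])
qed

text \<open>The tower rule. With finite supports both sides are finite sums, so no integrability
  condition arises.\<close>

lemma expectation_bind_finite:
  fixes f :: "'b \<Rightarrow> real"
  assumes "finite (set_pmf p)" "\<And>x. x \<in> set_pmf p \<Longrightarrow> finite (set_pmf (q x))"
  shows "measure_pmf.expectation (bind_pmf p q) f =
    measure_pmf.expectation p (\<lambda>x. measure_pmf.expectation (q x) f)"
  using pmf_expectation_bind[where h = f, OF assms order_refl]
    integral_measure_pmf[where M = p and f = "\<lambda>x. measure_pmf.expectation (q x) f", OF assms(1)]
  by simp

section \<open>Recursions for the mean total path length and the mean depth of the random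
  network\<close>

context
  fixes S :: "'v mgraph" and h :: 'v and k :: "nat \<Rightarrow> nat"
  assumes S: "seed S h" and k: "building_sequence (card (verts S)) k"
begin

text \<open>Condition (i) of a building sequence says exactly that enough vertices exist; thus the
  family of latch sets is nonempty and \<open>pmf_of_set\<close> is uniform on it.\<close>

lemma latches_le:
  assumes "G \<in> set_pmf (network S h k n)"
  shows "k n \<le> card (verts G)"
  using k card_verts_network[OF S k assms]
  unfolding building_sequence_def network_order_def sum_shift by simp

lemma finite_network: "finite (set_pmf (network S h k n))"
proof (induction n)
  case (Suc n)
  have "set_pmf (pmf_of_set {L. L \<subseteq> verts G \<and> card L = k n}) = {L. L \<subseteq> verts G \<and> card L = k n}"
    "finite {L. L \<subseteq> verts G \<and> card L = k n}"
    if "G \<in> set_pmf (network S h k n)" for G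
    using that latch_sets[OF _ latches_le[OF that]] network_invariant[OF S k that]
    by (auto intro: set_pmf_of_set)
  with Suc show ?case by auto
qed simp

lemma network_rooted:
  assumes "G \<in> set_pmf (network S h k n)"
  shows "rooted G (Root h)"
  using assms
proof (induction n arbitrary: G)
  case 0
  then show ?case using initial_network_rooted(1) seed_rooted[OF S] by simp
next
  case (Suc n)
  then obtain H L where H: "H \<in> set_pmf (network S h k n)"
    and L: "L \<in> set_pmf (pmf_of_set {L. L \<subseteq> verts H \<and> card L = k n})"
    and G: "G = hook_at S h (Suc n) L H" by auto
  note inv = network_invariant[OF S k H]
  have "L \<subseteq> verts H"
    using L latch_sets[OF _ latches_le[OF H]] inv by (simp add: set_pmf_of_set)
  \<comment> \<open>Such a name has \<open>born\<close> value \<open>Suc n\<close>, while all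
    vertices of \<open>H\<close> have at most \<open>n\<close>.\<close>
  moreover have "Copy (Suc n) l v \<notin> verts H" for l v
    using inv by force
  ultimately show ?case
    unfolding G using hook_at_rooted[OF seed_rooted[OF S] Suc.IH[OF H]] by blast
qed

lemma network_order_pos: "network_order S k n > 0"
  using S by (simp add: network_order_def seed_def)

definition mean_path_length :: "nat \<Rightarrow> real" where
  "mean_path_length n =
     measure_pmf.expectation (network S h k n) (\<lambda>G. real (total_path_length G (Root h)))"

lemma mean_path_length_0: "mean_path_length 0 = real (total_path_length S h)"
  by (simp add: mean_path_length_def initial_network_rooted(2)[OF seed_rooted[OF S]])

lemma expectation_hook_at:
  assumes H: "H \<in> set_pmf (network S h k n)"
  shows "measure_pmf.expectation (pmf_of_set {L. L \<subseteq> verts H \<and> card L = k n})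
      (\<lambda>L. real (total_path_length (hook_at S h (Suc n) L H) (Root h))) =
    real (network_order S k (Suc n)) / real (network_order S k n) *
      real (total_path_length H (Root h)) + real (k n) * real (total_path_length S h)"
proof -
  let ?A = "{L. L \<subseteq> verts H \<and> card L = k n}"
  let ?P = "real (total_path_length H (Root h))"
  let ?c = "real (card (verts S) - 1)"
  note inv = network_invariant[OF S k H]
  have ls: "finite ?A" "?A \<noteq> {}"
    using latch_sets[OF _ latches_le[OF H]] inv by auto
  then have fin: "finite (set_pmf (pmf_of_set ?A))"
    by (simp add: set_pmf_of_set)
  have fresh: "Copy (Suc n) l v \<notin> verts H" for l v
    using inv by force
  \<comment> \<open>For fixed \<open>H\<close> this isolates the only part that depends on
    \<open>L\<close>, the sum of the latch depths.\<close>
  have step: "real (total_path_length (hook_at S h (Suc n) L H) (Root h)) =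
      ?c * (\<Sum>l\<in>L. real (gdist H l (Root h))) +
      (?P + real (k n) * real (total_path_length S h))"
    if "L \<in> ?A" for L
    using that
      total_path_length_hook_at[OF seed_rooted[OF S] network_rooted[OF H], of L "Suc n"] fresh
    by simp
  have "measure_pmf.expectation (pmf_of_set ?A)
      (\<lambda>L. real (total_path_length (hook_at S h (Suc n) L H) (Root h))) =
    measure_pmf.expectation (pmf_of_set ?A) (\<lambda>L. ?c * (\<Sum>l\<in>L. real (gdist H l (Root h))) +
      (?P + real (k n) * real (total_path_length S h)))"
    using ls step by (intro integral_cong_AE) (auto simp: AE_measure_pmf_iff)
  also have "\<dots> = ?c * measure_pmf.expectation (pmf_of_set ?A)
      (\<lambda>L. \<Sum>l\<in>L. real (gdist H l (Root h))) + (?P + real (k n) * real (total_path_length S h))"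
    using fin by (subst Bochner_Integration.integral_add)
      (auto intro!: integrable_measure_pmf_finite)
  also have "measure_pmf.expectation (pmf_of_set ?A) (\<lambda>L. \<Sum>l\<in>L. real (gdist H l (Root h))) =
      real (k n) / real (network_order S k n) * ?P"
    using inv network_order_pos[of n] latches_le[OF H]
    by (subst expectation_uniform_subset) (auto simp: total_path_length_def)
  also have "?c * (real (k n) / real (network_order S k n) * ?P) +
        (?P + real (k n) * real (total_path_length S h)) =
      (real (network_order S k n) + ?c * real (k n)) / real (network_order S k n) * ?P +
        real (k n) * real (total_path_length S h)"
    using network_order_pos[of n] by (simp add: field_simps)
  also have "real (network_order S k n) + ?c * real (k n) = real (network_order S k (Suc n))"
    by (simp add: network_order_def distrib_left mult.commute)
  finally show ?thesis .
qed

text \<open>Given the current network, the expected new total is affine in the old one with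
  deterministic coefficients, so averaging over the network keeps the same form.\<close>

lemma mean_path_length_Suc:
  "mean_path_length (Suc n) =
     real (network_order S k (Suc n)) / real (network_order S k n) * mean_path_length n +
     real (k n) * real (total_path_length S h)"
proof -
  let ?A = "\<lambda>H. {L. L \<subseteq> verts H \<and> card L = k n}"
  have fin: "finite (set_pmf (pmf_of_set (?A H)))" if "H \<in> set_pmf (network S h k n)" for H
    using that latch_sets[OF _ latches_le[OF that]] network_invariant[OF S k that]
    by (simp add: set_pmf_of_set)
  have "mean_path_length (Suc n) = measure_pmf.expectation (network S h k n)
      (\<lambda>H. measure_pmf.expectation (pmf_of_set (?A H))
        (\<lambda>L. real (total_path_length (hook_at S h (Suc n) L H) (Root h))))"
    unfolding mean_path_length_def network.simps
    using fin finite_network[of n]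
    by (subst expectation_bind_finite)
      (auto simp: map_pmf_def[symmetric] intro!: integral_cong_AE)
  also have "\<dots> = measure_pmf.expectation (network S h k n)
      (\<lambda>H. real (network_order S k (Suc n)) / real (network_order S k n) *
        real (total_path_length H (Root h)) + real (k n) * real (total_path_length S h))"
    using expectation_hook_at by (intro integral_cong_AE) (auto simp: AE_measure_pmf_iff)
  also have "\<dots> = real (network_order S k (Suc n)) / real (network_order S k n) *
      mean_path_length n + real (k n) * real (total_path_length S h)"
    unfolding mean_path_length_def using finite_network[of n]
    by (subst Bochner_Integration.integral_add) (auto intro!: integrable_measure_pmf_finite)
  finally show ?thesis .
qed

text \<open>The order is the same for all networks in the support, so the division by it moves out
  of the expectation.\<close>

lemma expected_depth_eq:
  "expected_depth S h k n = mean_path_length n / real (network_order S k n)"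
proof -
  have V: "finite (verts G)" "verts G \<noteq> {}" if "G \<in> set_pmf (network S h k n)" for G
    using network_invariant[OF S k that] network_order_pos[of n] by auto
  have "expected_depth S h k n = measure_pmf.expectation (network S h k n)
      (\<lambda>G. measure_pmf.expectation (pmf_of_set (verts G)) (\<lambda>v. real (gdist G v (Root h))))"
    unfolding expected_depth_def depth_pmf_def
    using V finite_network[of n]
    by (subst expectation_bind_finite) (auto simp: map_pmf_def[symmetric] set_pmf_of_set)
  also have "\<dots> = measure_pmf.expectation (network S h k n)
      (\<lambda>G. real (total_path_length G (Root h)) / real (network_order S k n))"
    using V card_verts_network[OF S k]
    by (intro integral_cong_AE)
      (auto simp: AE_measure_pmf_iff integral_pmf_of_set total_path_length_def)
  finally show ?thesis by (simp add: mean_path_length_def)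
qed

text \<open>Dividing the recursion by the new order cancels the growth factor and leaves one summand
  of the final sum.\<close>

lemma expected_depth_Suc:
  "expected_depth S h k (Suc n) = expected_depth S h k n +
     real (total_path_length S h) * (real (k n) / real (network_order S k (Suc n)))"
  unfolding expected_depth_eq mean_path_length_Suc
  using network_order_pos[of n] network_order_pos[of "Suc n"] by (simp add: field_simps)

end

theorem corollary5p1:
  fixes S :: "'v mgraph" and h :: 'v and k :: "nat \<Rightarrow> nat" and n :: nat
  assumes "seed S h"
    and "building_sequence (card (verts S)) k"
  shows "expected_depth S h k n =
           real (total_path_length S h) *
             (\<Sum>i=1..n. real (k (i - 1)) / real (network_order S k i))
           + expected_depth S h k 0
       \<and> expected_depth S h k 0 = real (total_path_length S h) / real (card (verts S))"
proof
  show "expected_depth S h k n = real (total_path_length S h) *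
      (\<Sum>i=1..n. real (k (i - 1)) / real (network_order S k i)) + expected_depth S h k 0"
    by (induction n) (simp_all add: expected_depth_Suc[OF assms] algebra_simps)
  show "expected_depth S h k 0 = real (total_path_length S h) / real (card (verts S))"
    by (simp add: expected_depth_eq[OF assms] mean_path_length_0[OF assms] network_order_def)
qed

end
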